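(* Let $M_{a,b}$ be a singular arithmetical congruence monoid, where $a,b$ are integers greater than $1$ with $a\le b$, and let $\gcd(a,b)=\prod_{i=1}^m q_i^{r_i}$ with $q_1,\dots,q_m$ distinct primes and $r_i$ positive integers for every $i\in\{1,\dots,m\}$. Let $x\in M_{a,b}$ be such that $$x=\left(\prod_{i=1}^{m}q_i^{r_i+e_i}\right)\left(\prod_{j=1}^{n}p_j^{s_j}\right),$$ where $e_i\in\mathbb{N}_0$ for all $i$, $p_1,\dots,p_n$ are distinct primes, $s_j$ are positive integers, and $p_j\neq q_i$ for all $j\in\{1,\dots,n\}$ and $i\in\{1,\dots,m\}$. Then $$\omega(x)=\max\left\{1+\left\lceil\frac{r_1+e_1}{r_1}\right\rceil,\ \ldots,\ 1+\left\lceil\frac{r_m+e_m}{r_m}\right\rceil,\ \sum_{j=1}^{n}s_j\right\}.$$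
   Context: For integers $0<a\le b$ with $a^2\equiv a \pmod b$, the arithmetical congruence monoid (ACM) is $M_{a,b}=\{a+bk : k\in\mathbb{N}_0\}\cup\{1\}$ under multiplication; its only unit is $1$. It is called singular if $\gcd(a,b)\neq 1$ (equivalently $a\neq 1$). For $x,y$ in a commutative cancellative monoid $M$, $x\mid_M y$ means $y=xz$ for some $z\in M$. For a nonunit $x\in M$, the omega primality $\omega(x)=\omega_M(x)$ is the smallest positive integer $m$ such that whenever $k>m$ and $a_1,\dots,a_k\in M$ satisfy $x\mid_M \prod_{i=1}^k a_i$, there is a proper subset $S\subsetneq\{1,\dots,k\}$ with $x\mid_M\prod_{i\in S}a_i$; if no such $m$ exists, $\omega(x)=\infty$. *)

theory Defs
  imports
    "HOL-Algebra.Divisibility"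
    "HOL-Algebra.FiniteProduct"
    "HOL-Number_Theory.Cong"
    "HOL-Library.Extended_Nat"
begin

definition acm :: "nat \<Rightarrow> nat \<Rightarrow> nat monoid" where
  "acm a b = \<lparr>carrier = {a + b * k | k. True} \<union> {1}, mult = (*), one = 1\<rparr>"

lemma acm_comm_monoid_cancel:
  fixes a b :: nat
  assumes "0 < a" "a \<le> b" "[a\<^sup>2 = a] (mod b)"
  shows "comm_monoid_cancel (acm a b)"
proof -
  have "a \<le> a\<^sup>2"
    using assms(1) by (simp add: power2_eq_square)
  moreover have "b dvd a\<^sup>2 - a"
    using assms(3) calculation by (metis cong_altdef_nat)
  ultimately obtain c where "a\<^sup>2 = a + b * c"
    by (metis dvdE le_add_diff_inverse)
  then have c: "a * a = a + b * c"
    by (simp add: power2_eq_square)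
  have "\<exists>j. (a + b * k) * (a + b * l) = a + b * j" for k l
  proof
    show "(a + b * k) * (a + b * l) = a + b * (c + a * l + a * k + b * k * l)"
      using c by (simp add: algebra_simps)
  qed
  then have closed: "x * y \<in> carrier (acm a b)"
    if "x \<in> carrier (acm a b)" "y \<in> carrier (acm a b)" for x y
    using that by (auto simp: acm_def)
  have pos: "0 < x" if "x \<in> carrier (acm a b)" for x
    using that assms(1) by (auto simp: acm_def)
  have "comm_monoid (acm a b)"
  proof (rule comm_monoidI)
    fix x y
    assume "x \<in> carrier (acm a b)" "y \<in> carrier (acm a b)"
    then show "x \<otimes>\<^bsub>acm a b\<^esub> y \<in> carrier (acm a b)"
      using closed by (simp add: acm_def)
  qed (simp_all add: acm_def)
  then show ?thesis
  proof (rule comm_monoid_cancelI)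
    fix x y z
    assume "x \<otimes>\<^bsub>acm a b\<^esub> z = y \<otimes>\<^bsub>acm a b\<^esub> z" "z \<in> carrier (acm a b)"
    then show "x = y"
      using pos[of z] by (simp add: acm_def)
  qed
qed

text \<open>
  The set of admissible \<open>m\<close> may be empty, in which case the infimum in \<^typ>\<open>enat\<close> is \<open>\<infinity>\<close>.
  The subset \<open>S\<close> may be empty; the empty product is the identity. The value is only meaningful
  for a nonunit \<open>x\<close> of a commutative cancellative monoid \<open>G\<close>.
\<close>

definition omega_primality :: "('a, 'b) monoid_scheme \<Rightarrow> 'a \<Rightarrow> enat" where
  "omega_primality G x =
     (INF m \<in> {m :: nat. 0 < m \<and>
        (\<forall>k > m. \<forall>f \<in> {1..k} \<rightarrow> carrier G.
           x divides\<^bsub>G\<^esub> (\<Otimes>\<^bsub>G\<^esub>i\<in>{1..k}. f i) \<longrightarrow>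
           (\<exists>S. S \<subset> {1..k} \<and> x divides\<^bsub>G\<^esub> (\<Otimes>\<^bsub>G\<^esub>i\<in>S. f i)))}. enat m)"

end

theory Submission
  imports Defs
begin

text \<open>
  Let \<open>d = gcd a b\<close> and \<open>f = b / d\<close>. Since \<open>f\<close> divides \<open>a - 1\<close>, it is coprime to \<open>d\<close>, and by the
  Chinese remainder theorem the nonunits of \<open>M\<^bsub>a,b\<^esub>\<close> are the positive multiples of \<open>d\<close> that are
  \<open>1\<close> modulo \<open>f\<close>. Hence \<open>x\<close> divides \<open>y\<close> in the monoid iff \<open>y = x\<close> or \<open>x d\<close> divides \<open>y\<close> in the
  integers. Write \<open>x = Q P\<close>, where \<open>Q\<close> collects the primes dividing \<open>d\<close>. Any \<open>N\<close> nonunits have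
  a product divisible by \<open>d\<^sup>N\<close>, which takes care of \<open>Q d\<close> as soon as
  \<open>N \<ge> 1 + \<lceil>(r\<^sub>i + e\<^sub>i) / r\<^sub>i\<rceil>\<close> for all \<open>i\<close>, and \<open>P\<close> needs at most one factor for each of its prime
  factors; this gives the upper bound. For the lower bounds one takes either copies of one
  element in which \<open>q\<^sub>i\<close> occurs only to the power \<open>r\<^sub>i\<close> and all other primes of \<open>x d\<close> occur
  sufficiently often, or one element for each prime factor of \<open>P\<close> that contains only this prime
  factor of \<open>P\<close>.
\<close>

section \<open>Large solutions of congruences\<close>

lemma obtain_large_cong:
  fixes m n u v B :: nat
  assumes "coprime m n" "0 < m" "0 < n"
  obtains t where "[t = u] (mod m)" "[t = v] (mod n)" "B < t"
proof -
  obtain t where t: "[t = u] (mod m)" "[t = v] (mod n)"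
    using binary_chinese_remainder_nat[OF assms(1)] by blast
  \<comment> \<open>Adding a multiple of \<open>m * n\<close> keeps both residues and pushes the
    solution above \<open>B\<close>.\<close>
  let ?t = "t + m * n * Suc B"
  have "?t = t + m * (n * Suc B)" "?t = t + n * (m * Suc B)"
    by (simp_all only: ac_simps)
  then have "[?t = t] (mod m)" "[?t = t] (mod n)"
    unfolding cong_def by (metis mod_mult_self2)+
  then have "[?t = u] (mod m)" "[?t = v] (mod n)"
    using t cong_trans by blast+
  moreover have "1 * Suc B \<le> m * n * Suc B"
    using assms(2,3) by (intro mult_right_mono) auto
  then have "B < ?t"
    by simp
  ultimately show thesis
    using that by blast
qed

text \<open>Supplies the cofactor that turns \<open>c\<close> into an element congruent to 1 modulo
  \<open>f\<close> without bringing in a prime of \<open>h\<close>. The residue 1 modulo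
  \<open>h\<close> ensures the latter; the bound \<open>B\<close> later makes the element exceed
  \<open>x\<close>.\<close>

lemma obtain_large_inverse_mod:
  fixes c f h B :: nat
  assumes "coprime c f" "coprime f h" "0 < f" "0 < h"
  obtains t where "[c * t = 1] (mod f)" "coprime t h" "B < t"
proof -
  obtain v where v: "[c * v = 1] (mod f)"
    using cong_solve_coprime_nat[OF assms(1)] by auto
  obtain t where t: "[t = v] (mod f)" "[t = 1] (mod h)" "B < t"
    using obtain_large_cong[OF assms(2-4)] by metis
  have "[c * t = 1] (mod f)"
    using v t(1) cong_scalar_left cong_trans by blast
  moreover have "coprime t h"
    using t(2) by (metis cong_imp_coprime cong_sym coprime_1_left)
  ultimately show thesis
    using that t(3) by blast
qed

section \<open>Products of primes counted with multiplicity\<close>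

text \<open>Each prime of \<open>A\<close> can be charged to one factor. A prime \<open>p\<close>
  divides some \<open>g i\<close>; cancelling it there gives \<open>g'\<close>, to which the
  induction hypothesis applies. The index \<open>i\<close> may already have been chosen, hence only
  an upper bound on \<open>card T\<close>.\<close>

lemma small_subset_prod_dvd:
  fixes g :: "'i \<Rightarrow> nat" and A :: "nat multiset"
  assumes "finite I" and "\<And>p. p \<in># A \<Longrightarrow> Factorial_Ring.prime p"
    and "prod_mset A dvd (\<Prod>i\<in>I. g i)"
  shows "\<exists>T\<subseteq>I. card T \<le> size A \<and> prod_mset A dvd (\<Prod>i\<in>T. g i)"
  using assms(2,3)
proof (induction A arbitrary: g)
  case empty
  show ?case
    by (intro exI[of _ "{}"]) auto
next
  case (add p A)
  have p: "Factorial_Ring.prime p"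
    using add.prems(1) by simp
  have "p dvd (\<Prod>i\<in>I. g i)"
    using add.prems(2) dvd_trans[OF dvd_triv_left] by auto
  then obtain i where i: "i \<in> I" "p dvd g i"
    using p assms(1) by (metis prime_dvd_prod_iff)
  define g' where "g' = g(i := g i div p)"
  have split: "(\<Prod>j\<in>T. g j) = p * (\<Prod>j\<in>T. g' j)" if "finite T" "i \<in> T" for T
  proof -
    have "(\<Prod>j\<in>T - {i}. g j) = (\<Prod>j\<in>T - {i}. g' j)"
      by (intro prod.cong) (auto simp: g'_def)
    moreover have "g i = p * g' i"
      using i(2) by (simp add: g'_def)
    ultimately show ?thesis
      using prod.remove[OF that, of g] prod.remove[OF that, of g'] by (simp add: mult.assoc)
  qed
  have "0 < p"
    using p prime_gt_0_nat by blast
  have "prod_mset A dvd (\<Prod>j\<in>I. g' j)"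
    using add.prems(2) split[OF assms(1) i(1)] \<open>0 < p\<close> by simp
  then obtain T where T: "T \<subseteq> I" "card T \<le> size A" "prod_mset A dvd (\<Prod>j\<in>T. g' j)"
    using add.IH[of g'] add.prems(1) by auto
  have fin: "finite T"
    using T(1) assms(1) finite_subset by blast
  have "(\<Prod>j\<in>T. g' j) dvd (\<Prod>j\<in>insert i T. g' j)"
    using fin by (intro prod_dvd_prod_subset) auto
  then have "prod_mset (add_mset p A) dvd (\<Prod>j\<in>insert i T. g j)"
    using T(3) split[of "insert i T"] fin by (auto intro: mult_dvd_mono dvd_trans)
  moreover have "card (insert i T) \<le> size (add_mset p A)"
    using T(2) card_insert_le_m1[of "Suc (size A)" T i] by simp
  ultimately show ?case
    using T(1) i(1) by (intro exI[of _ "insert i T"]) auto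
qed

lemma prod_prime_powers_as_prod_mset:
  fixes p s :: "nat \<Rightarrow> nat"
  assumes "finite J" and "\<And>j. j \<in> J \<Longrightarrow> Factorial_Ring.prime (p j)"
  obtains A where "prod_mset A = (\<Prod>j\<in>J. p j ^ s j)" "size A = (\<Sum>j\<in>J. s j)"
    "\<And>c. c \<in># A \<Longrightarrow> Factorial_Ring.prime c"
proof
  let ?A = "\<Sum>j\<in>J. replicate_mset (s j) (p j)"
  show "prod_mset ?A = (\<Prod>j\<in>J. p j ^ s j)"
    using assms(1) by (induction J) auto
  show "size ?A = (\<Sum>j\<in>J. s j)"
    by (simp add: size_multiset_sum)
  show "Factorial_Ring.prime c" if "c \<in># ?A" for c
    using that assms by (auto simp: set_mset_sum split: if_splits)
qed

lemma obtain_indexed_mset: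
  obtains c where "prod_mset A = (\<Prod>i=1..size A. c i)" "\<And>i. i \<in> {1..size A} \<Longrightarrow> c i \<in># A"
proof -
  obtain xs where xs: "mset xs = A"
    using ex_mset by blast
  let ?c = "\<lambda>i. xs ! (i - 1)"
  have "prod_mset A = prod_list xs"
    using xs by (metis prod_mset_prod_list)
  also have "\<dots> = (\<Prod>i<length xs. xs ! i)"
    by (simp add: prod.list_conv_set_nth atLeast0LessThan)
  also have "\<dots> = (\<Prod>i=1..length xs. ?c i)"
    by (rule prod.reindex_bij_witness[of _ "\<lambda>i. i - 1" Suc]) auto
  finally have "prod_mset A = (\<Prod>i=1..size A. ?c i)"
    using xs by auto
  moreover have "?c i \<in># A" if "i \<in> {1..size A}" for i
    using that xs nth_mem_mset[of "i - 1" xs] by auto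
  ultimately show thesis
    using that by blast
qed

section \<open>Membership and divisibility in a singular ACM\<close>

locale singular_acm =
  fixes a b :: nat
  assumes a_gt_1: "1 < a" and a_le_b: "a \<le> b"
    and idem: "[a\<^sup>2 = a] (mod b)"
    and singular: "gcd a b \<noteq> 1"
begin

definition d :: nat where "d = gcd a b"

definition f :: nat where "f = b div d"

abbreviation M :: "nat monoid" where "M \<equiv> acm a b"

sublocale comm_monoid_cancel M
  using acm_comm_monoid_cancel a_gt_1 a_le_b idem by simp

lemma b_eq: "b = d * f"
  by (simp add: d_def f_def)

lemma d_gt_1: "1 < d"
proof -
  have "d \<noteq> 0" "d \<noteq> 1"
    using a_gt_1 singular by (simp_all add: d_def)
  then show ?thesis
    by linarith
qed

lemma f_pos: "0 < f"
  using a_gt_1 a_le_b b_eq by (cases f) auto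

text \<open>Idempotence says that \<open>b = d * f\<close> divides \<open>a * (a - 1)\<close>.
  Cancelling \<open>d\<close> leaves \<open>f\<close> dividing \<open>a' * (a - 1)\<close>, and
  \<open>a' = a div d\<close> is coprime to \<open>f = b div d\<close>.\<close>

lemma a_cong_1: "[a = 1] (mod f)"
proof -
  have "[a * a = a * 1] (mod b)"
    using idem by (simp add: power2_eq_square)
  then have "int b dvd int a * (int a - 1)"
    by (simp add: cong_iff_dvd_diff right_diff_distrib flip: cong_int_iff)
  moreover obtain a' where a': "a = d * a'" "coprime a' f"
  proof -
    have "coprime (a div d) (b div d)"
      using a_gt_1 unfolding d_def by (intro div_gcd_coprime) auto
    moreover have "a = d * (a div d)"
      by (simp add: d_def)
    ultimately show thesis
      using that by (simp add: f_def)
  qed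
  ultimately have "int d * int f dvd int d * (int a' * (int a - 1))"
    using b_eq by (metis mult.assoc of_nat_mult)
  then have "int f dvd int a' * (int a - 1)"
    using d_gt_1 by simp
  then have "int f dvd int a - 1"
    using a'(2) coprime_dvd_mult_right_iff[of "int f" "int a'"]
    by (simp add: coprime_commute)
  then show ?thesis
    by (simp add: cong_iff_dvd_diff flip: cong_int_iff)
qed

lemma coprime_d_f: "coprime d f"
proof -
  have "coprime a f"
    using a_cong_1 by (metis cong_imp_coprime cong_sym coprime_1_left)
  then show ?thesis
    by (rule coprime_divisors[rotated 2]) (simp_all add: d_def)
qed

lemma carrier_iff: "y \<in> carrier M \<longleftrightarrow> y = 1 \<or> 0 < y \<and> d dvd y \<and> [y = 1] (mod f)"
proof -
  have "(\<exists>k. y = a + b * k) \<longleftrightarrow> 0 < y \<and> d dvd y \<and> [y = 1] (mod f)"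
  proof
    assume "\<exists>k. y = a + b * k"
    then obtain k where y: "y = a + b * k" ..
    have "y = a + f * (d * k)"
      using y b_eq by (metis mult.assoc mult.commute)
    then have "[y = a] (mod f)"
      by (simp add: cong_def)
    then show "0 < y \<and> d dvd y \<and> [y = 1] (mod f)"
      using a_gt_1 a_cong_1 cong_trans by (auto simp: y d_def)
  next
    assume y: "0 < y \<and> d dvd y \<and> [y = 1] (mod f)"
    have "[y = a] (mod d)"
      using y by (simp add: cong_def d_def)
    moreover have "[y = a] (mod f)"
      using y a_cong_1 cong_sym cong_trans by blast
    ultimately have cong: "[y = a] (mod b)"
      by (metis b_eq coprime_d_f coprime_cong_mult_nat)
    \<comment> \<open>A positive \<open>y\<close> below \<open>a\<close> in the same class would
      give \<open>b \<le> a - y < a\<close>, against \<open>a \<le> b\<close>.\<close>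
    have "a \<le> y"
    proof (rule ccontr)
      assume "\<not> a \<le> y"
      then have "b dvd a - y"
        using cong by (metis cong_altdef_nat cong_sym nat_le_linear)
      then have "b \<le> a - y"
        using \<open>\<not> a \<le> y\<close> by (intro dvd_imp_le) auto
      then show False
        using y a_le_b \<open>\<not> a \<le> y\<close> by linarith
    qed
    then have "b dvd y - a"
      using cong by (simp add: cong_altdef_nat)
    then show "\<exists>k. y = a + b * k"
      using \<open>a \<le> y\<close> by (metis dvdE le_add_diff_inverse)
  qed
  then show ?thesis
    by (auto simp: acm_def)
qed

lemma mult_M [simp]: "y \<otimes>\<^bsub>M\<^esub> z = y * z"
  and one_M [simp]: "\<one>\<^bsub>M\<^esub> = 1"
  by (simp_all add: acm_def)

lemma finprod_M:
  assumes "finite S" "g \<in> S \<rightarrow> carrier M"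
  shows "(\<Otimes>\<^bsub>M\<^esub>i\<in>S. g i) = (\<Prod>i\<in>S. g i)"
  using assms
proof (induction S)
  case (insert i S)
  then have "g \<in> S \<rightarrow> carrier M" "g i \<in> carrier M"
    by auto
  then show ?case
    using insert by simp
qed simp

lemma prod_in_carrier:
  assumes "finite S" "g \<in> S \<rightarrow> carrier M"
  shows "(\<Prod>i\<in>S. g i) \<in> carrier M"
  using finprod_closed[OF assms(2)] finprod_M[OF assms] by simp

lemma coprime_f:
  assumes "y \<in> carrier M"
  shows "coprime y f"
proof -
  have "[y = 1] (mod f)"
    using assms carrier_iff[of y] by auto
  then show ?thesis
    by (metis cong_imp_coprime cong_sym coprime_1_left)
qed

text \<open>The quotient in the monoid is either 1 or a multiple of \<open>d\<close>. Conversely, a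
  cofactor \<open>d * z\<close> needs no separate congruence condition: \<open>x\<close> and
  \<open>y\<close> are both 1 modulo \<open>f\<close>, so cancelling \<open>x\<close> shows that
  \<open>d * z\<close> is too.\<close>

lemma divides_iff:
  assumes "x \<in> carrier M" "x \<noteq> 1" "y \<in> carrier M"
  shows "x divides\<^bsub>M\<^esub> y \<longleftrightarrow> y = x \<or> x * d dvd y"
proof
  assume "x divides\<^bsub>M\<^esub> y"
  then obtain z where "z \<in> carrier M" "y = x * z"
    by (auto simp: factor_def)
  then show "y = x \<or> x * d dvd y"
    using carrier_iff[of z] by auto
next
  assume "y = x \<or> x * d dvd y"
  then show "x divides\<^bsub>M\<^esub> y"
  proof
    assume "y = x"
    then show ?thesis
      using assms(1) by simp
  next
    assume "x * d dvd y"
    then obtain z where z: "y = x * d * z" ..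
    have x: "0 < x" "d dvd x" "[x = 1] (mod f)"
      using assms(1,2) carrier_iff by auto
    have "y \<noteq> 1"
      using z x(1) d_gt_1 by auto
    then have y: "0 < y" "[y = 1] (mod f)"
      using assms(3) carrier_iff by auto
    have "[x * (d * z) = x * 1] (mod f)"
      using cong_trans[OF y(2) cong_sym[OF x(3)]] by (simp add: z mult.assoc)
    then have "[d * z = 1] (mod f)"
      using coprime_f[OF assms(1)] cong_mult_lcancel_nat by blast
    moreover have "0 < d * z"
      using y(1) z by (cases "d * z") (auto simp: mult.assoc)
    ultimately have "d * z \<in> carrier M"
      using carrier_iff by auto
    then show ?thesis
      using z by (auto simp: factor_def mult.assoc)
  qed
qed

lemma power_dvd_prod:
  assumes "finite S" "g \<in> S \<rightarrow> carrier M - {1}"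
  shows "d ^ card S dvd (\<Prod>i\<in>S. g i)"
proof -
  have "(\<Prod>i\<in>S. d) dvd (\<Prod>i\<in>S. g i)"
    using assms(2) carrier_iff by (intro prod_dvd_prod) auto
  then show ?thesis
    by simp
qed

section \<open>Upper bound for omega primality\<close>

text \<open>Isolates the condition under the infimum, so that both bounds become statements about a
  single natural number \<open>m\<close>.\<close>

definition omega_bound :: "nat \<Rightarrow> nat \<Rightarrow> bool" where
  "omega_bound x m \<longleftrightarrow> 0 < m \<and>
     (\<forall>k > m. \<forall>g \<in> {1..k} \<rightarrow> carrier M.
        x divides\<^bsub>M\<^esub> (\<Otimes>\<^bsub>M\<^esub>i\<in>{1..k}. g i) \<longrightarrow>
        (\<exists>S. S \<subset> {1..k} \<and> x divides\<^bsub>M\<^esub> (\<Otimes>\<^bsub>M\<^esub>i\<in>S. g i)))"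

lemma omega_primality_eqI:
  assumes "omega_bound x N" and "\<And>m. omega_bound x m \<Longrightarrow> N \<le> m"
  shows "omega_primality M x = enat N"
  unfolding omega_primality_def omega_bound_def[symmetric]
proof (rule antisym)
  show "(INF m\<in>{m. omega_bound x m}. enat m) \<le> enat N"
    using assms(1) by (intro INF_lower) simp
  show "enat N \<le> (INF m\<in>{m. omega_bound x m}. enat m)"
    using assms(2) by (intro INF_greatest) simp
qed

lemma omega_bound_upper:
  assumes x: "x \<in> carrier M" "x \<noteq> 1" "x = Q * prod_mset A"
    and A: "\<And>p. p \<in># A \<Longrightarrow> Factorial_Ring.prime p"
    and cop: "coprime d (prod_mset A)"
    and Q: "Q * d dvd d ^ N"
    and N: "0 < N" "size A \<le> N"
  shows "omega_bound x N"
  unfolding omega_bound_def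
proof (intro conjI allI impI ballI)
  fix k g
  assume k: "N < k" and g: "g \<in> {1..k} \<rightarrow> carrier M"
    and "x divides\<^bsub>M\<^esub> (\<Otimes>\<^bsub>M\<^esub>i\<in>{1..k}. g i)"
  then have div: "x divides\<^bsub>M\<^esub> (\<Prod>i=1..k. g i)"
    using finprod_M[OF _ g] by simp
  have "\<exists>S. S \<subset> {1..k} \<and> x divides\<^bsub>M\<^esub> (\<Prod>i\<in>S. g i)"
  \<comment> \<open>A unit factor can simply be dropped; otherwise every factor is a multiple of
    \<open>d\<close>.\<close>
  proof (cases "\<exists>i\<in>{1..k}. g i = 1")
    case True
    then obtain i where i: "i \<in> {1..k}" "g i = 1" ..
    then have "(\<Prod>j=1..k. g j) = (\<Prod>j\<in>{1..k} - {i}. g j)"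
      using prod.remove[of "{1..k}" i g] by simp
    then show ?thesis
      using div i(1) by (intro exI[of _ "{1..k} - {i}"] conjI) (blast, metis)
  next
    case False
    then have g': "g \<in> S \<rightarrow> carrier M - {1}" if "S \<subseteq> {1..k}" for S
      using g that by (auto simp: Pi_def subset_iff)
    have "0 < x"
      using x(1,2) carrier_iff by auto
    then have "0 < Q"
      using x(3) by (cases Q) auto
    have cop': "coprime (d ^ l) (prod_mset A)" for l
      using cop by simp
    \<comment> \<open>More than \<open>N\<close> nonunits cannot multiply to \<open>x\<close>
      itself: \<open>d ^ k\<close> would divide \<open>Q\<close>, while \<open>Q * d\<close> divides
      \<open>d ^ N\<close> and hence \<open>d ^ k\<close>.\<close>
    have "(\<Prod>i=1..k. g i) \<noteq> x"
    proof
      assume "(\<Prod>i=1..k. g i) = x"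
      then have "d ^ k dvd Q * prod_mset A"
        using power_dvd_prod[OF _ g', of "{1..k}"] x(3) by simp
      then have "d ^ k dvd Q"
        using cop' coprime_dvd_mult_left_iff by blast
      then have "Q * d dvd Q * 1"
        using Q le_imp_power_dvd[of N k d] k dvd_trans by (metis less_imp_le mult.right_neutral)
      then show False
        using \<open>0 < Q\<close> d_gt_1 by simp
    qed
    then have "x * d dvd (\<Prod>i=1..k. g i)"
      using div divides_iff x(1,2) prod_in_carrier[OF _ g] by auto
    then have "prod_mset A dvd (\<Prod>i=1..k. g i)"
      by (rule dvd_trans[rotated]) (simp add: x(3) mult.assoc)
    then obtain T where T: "T \<subseteq> {1..k}" "card T \<le> size A" "prod_mset A dvd (\<Prod>i\<in>T. g i)"
      using small_subset_prod_dvd[of "{1..k}" A g] A by auto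
    have "card T \<le> N"
      using T(2) N(2) by linarith
    \<comment> \<open>\<open>T\<close> takes care of \<open>prod_mset A\<close>. Padding it to
      exactly \<open>N\<close> indices makes \<open>d ^ N\<close>, and so \<open>Q * d\<close>,
      divide the product, while \<open>N < k\<close> keeps \<open>S\<close> proper.\<close>
    then obtain S where S: "T \<subseteq> S" "S \<subseteq> {1..k}" "card S = N"
      using exists_subset_between[of T N "{1..k}"] T(1) k by auto
    have fin: "finite S"
      using S(2) finite_subset by blast
    have "d ^ N dvd (\<Prod>i\<in>S. g i)"
      using power_dvd_prod[OF fin g'[OF S(2)]] S(3) by simp
    moreover have "prod_mset A dvd (\<Prod>i\<in>S. g i)"
      using T(3) prod_dvd_prod_subset[OF fin S(1), of g] dvd_trans by blast
    ultimately have "d ^ N * prod_mset A dvd (\<Prod>i\<in>S. g i)"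
      using cop' by (intro divides_mult)
    moreover have "x * d dvd d ^ N * prod_mset A"
      using mult_dvd_mono[OF Q dvd_refl[of "prod_mset A"]] x(3) by (simp add: ac_simps)
    moreover have "(\<Prod>i\<in>S. g i) \<in> carrier M"
      using prod_in_carrier[OF fin] g' S(2) by blast
    ultimately have "x divides\<^bsub>M\<^esub> (\<Prod>i\<in>S. g i)"
      using divides_iff[OF x(1,2)] dvd_trans[of "x * d"] by metis
    moreover have "S \<subset> {1..k}"
      using S(2,3) k by auto
    ultimately show ?thesis
      by blast
  qed
  then obtain S where S: "S \<subset> {1..k}" "x divides\<^bsub>M\<^esub> (\<Prod>i\<in>S. g i)"
    by blast
  then have "(\<Otimes>\<^bsub>M\<^esub>i\<in>S. g i) = (\<Prod>i\<in>S. g i)"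
    using g finite_subset[of S "{1..k}"] by (intro finprod_M) auto
  then show "\<exists>S. S \<subset> {1..k} \<and> x divides\<^bsub>M\<^esub> (\<Otimes>\<^bsub>M\<^esub>i\<in>S. g i)"
    using S by metis
qed (rule N(1))

lemma omega_bound_ge:
  assumes "omega_bound x m"
    and g: "g \<in> {1..k} \<rightarrow> carrier M" "x divides\<^bsub>M\<^esub> (\<Prod>i=1..k. g i)"
    and irred: "\<And>S. S \<subset> {1..k} \<Longrightarrow> \<not> x divides\<^bsub>M\<^esub> (\<Prod>i\<in>S. g i)"
  shows "k \<le> m"
proof (rule ccontr)
  assume "\<not> k \<le> m"
  moreover have "x divides\<^bsub>M\<^esub> (\<Otimes>\<^bsub>M\<^esub>i\<in>{1..k}. g i)"
    using g(2) finprod_M[OF _ g(1)] by simp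
  ultimately obtain S where S: "S \<subset> {1..k}" "x divides\<^bsub>M\<^esub> (\<Otimes>\<^bsub>M\<^esub>i\<in>S. g i)"
    using assms(1) g(1) unfolding omega_bound_def by (meson not_le)
  moreover have "(\<Otimes>\<^bsub>M\<^esub>i\<in>S. g i) = (\<Prod>i\<in>S. g i)"
    using S(1) g(1) finite_subset[of S "{1..k}"] by (intro finprod_M) auto
  ultimately show False
    using irred by simp
qed

text \<open>The family consists of \<open>N\<close> copies of one element \<open>y\<close> whose
  \<open>q\<close>-exponent is exactly \<open>r\<close>, while \<open>x * d\<close> has
  \<open>q\<close>-exponent \<open>2 * r + e\<close>. The assumptions on \<open>N\<close> make it
  the least number of copies that reaches this exponent. The remaining part \<open>u\<close> of
  \<open>x * d\<close> divides \<open>y\<close>, so it is no obstacle.\<close>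

lemma omega_bound_ge_singular_prime:
  assumes bound: "omega_bound x m"
    and x: "x \<in> carrier M" "x \<noteq> 1" "x = q ^ (r + e) * x'"
    and d: "d = q ^ r * d'"
    and q: "Factorial_Ring.prime q" "coprime q x'" "coprime q d'"
    and r: "0 < r" "2 * r + e \<le> N * r" "(N - 1) * r < 2 * r + e"
  shows "N \<le> m"
proof -
  define u where "u = x' * d'"
  have "0 < x"
    using x(1,2) carrier_iff by auto
  have xd: "x * d = q ^ (2 * r + e) * u"
  proof -
    have "2 * r + e = (r + e) + r"
      by simp
    then show ?thesis
      by (simp only: x(3) d u_def power_add ac_simps)
  qed
  have "0 < x * d"
    using \<open>0 < x\<close> d_gt_1 by simp
  then have "0 < u"
    using xd by (cases u) auto
  have "0 < q"
    using q(1) prime_gt_0_nat by blast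
  have "coprime (x * d) f"
    using coprime_f[OF x(1)] coprime_d_f by simp
  then have cop_f: "coprime u f" "coprime q f"
    using r(1) by (auto simp: xd)
  have "coprime (q ^ r * u) f" "coprime f q"
    using cop_f by (auto simp: coprime_commute)
  \<comment> \<open>The congruence puts \<open>y\<close> into the monoid, coprimality to
    \<open>q\<close> fixes its \<open>q\<close>-exponent, and \<open>x < t\<close> will exclude that
    a power of \<open>y\<close> equals \<open>x\<close>.\<close>
  then obtain t where t: "[q ^ r * u * t = 1] (mod f)" "coprime t q" "x < t"
    using obtain_large_inverse_mod f_pos \<open>0 < q\<close> by metis
  define y where "y = q ^ r * u * t"
  have "1 * t \<le> q ^ r * u * t"
    using \<open>0 < q\<close> \<open>0 < u\<close> by (intro mult_right_mono) (auto simp: Suc_le_eq)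
  then have "x < y"
    using t(3) by (simp only: y_def mult_1)
  have "d dvd y"
    by (simp add: d y_def u_def mult.assoc mult_dvd_mono)
  moreover have "[y = 1] (mod f)"
    using t(1) by (simp only: y_def)
  ultimately have y: "y \<in> carrier M"
    using carrier_iff[of y] \<open>x < y\<close> by auto
  have "0 < N"
    using r(1,2) by (cases N) auto
  have y_pow: "y ^ l = q ^ (l * r) * (u * t) ^ l" for l
    by (simp add: y_def mult.assoc power_mult_distrib mult.commute[of l r] power_mult)
  have "x * d dvd y ^ N"
  proof -
    have "u dvd (u * t) ^ N"
      using \<open>0 < N\<close> by (metis dvd_power dvd_trans dvd_triv_left)
    then show ?thesis
      unfolding xd y_pow using r(2) by (intro mult_dvd_mono le_imp_power_dvd)
  qed
  then have "x divides\<^bsub>M\<^esub> (\<Prod>i=1..N. y)"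
    using divides_iff[OF x(1,2), of "y ^ N"] prod_in_carrier[of "{1..N}" "\<lambda>_. y"] y by simp
  moreover have "\<not> x divides\<^bsub>M\<^esub> (\<Prod>i\<in>S. y)" if S: "S \<subset> {1..N}" for S
  proof
    assume "x divides\<^bsub>M\<^esub> (\<Prod>i\<in>S. y)"
    moreover have "finite S"
      using S finite_subset by blast
    ultimately have *: "y ^ card S = x \<or> x * d dvd y ^ card S"
      using divides_iff[OF x(1,2), of "y ^ card S"] prod_in_carrier[of S "\<lambda>_. y"] y by simp
    have "card S < N"
      using psubset_card_mono[OF _ S] by simp
    show False
    \<comment> \<open>The empty product 1 is neither \<open>x\<close> nor a multiple of
      \<open>x * d\<close>. A nonempty one is at least \<open>y > x\<close>, which leaves only
      divisibility by \<open>x * d\<close>.\<close>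
    proof (cases "card S")
      case 0
      then show False
        using * x(2) d_gt_1 by auto
    next
      case (Suc c)
      then have "y ^ 1 \<le> y ^ card S"
        using \<open>x < y\<close> by (intro power_increasing) auto
      then have "x * d dvd y ^ card S"
        using * \<open>x < y\<close> by auto
      then have "q ^ (2 * r + e) dvd y ^ card S"
        unfolding xd by (rule dvd_mult_left)
      also have "y ^ card S = q ^ (card S * r) * (u * t) ^ card S"
        by (rule y_pow)
      finally have "q ^ (2 * r + e) dvd q ^ (card S * r)"
        using q(2,3) t(2) by (subst (asm) coprime_dvd_mult_left_iff) (auto simp: u_def coprime_commute)
      then have "2 * r + e \<le> card S * r"
        using q(1) by (metis power_dvd_imp_le prime_gt_1_nat)
      also have "\<dots> \<le> (N - 1) * r"
        using \<open>card S < N\<close> by (intro mult_right_mono) auto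
      finally show False
        using r(3) by simp
    qed
  qed
  ultimately show ?thesis
    using omega_bound_ge[OF bound, of "\<lambda>_. y" N] y by auto
qed

text \<open>One monoid element \<open>g i\<close> is built for each prime \<open>c i\<close> of
  \<open>A\<close>, counted with multiplicity. Its other part \<open>w i\<close> is coprime to
  \<open>prod_mset A\<close>, so omitting any factor loses a prime that no other factor can
  replace.\<close>

lemma omega_bound_ge_size:
  assumes bound: "omega_bound x m"
    and x: "x \<in> carrier M" "x \<noteq> 1" "x = Q * prod_mset A"
    and A: "\<And>p. p \<in># A \<Longrightarrow> Factorial_Ring.prime p"
    and cop: "coprime Q (prod_mset A)" "coprime d (prod_mset A)"
  shows "size A \<le> m"
proof (cases "A = {#}")
  case False
  define P where "P = prod_mset A"
  define k where "k = size A"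
  obtain c where c: "P = (\<Prod>i=1..k. c i)" "\<And>i. i \<in> {1..k} \<Longrightarrow> c i \<in># A"
    using obtain_indexed_mset[of A] unfolding P_def k_def by metis
  have "0 < x"
    using x(1,2) carrier_iff by auto
  then have "0 < P" "0 < Q"
    using x(3) by (cases P; auto simp: P_def)+
  have "coprime x f"
    using coprime_f x(1) by blast
  then have cop_f: "coprime Q f" "coprime P f"
    by (auto simp: x(3) P_def)
  have "\<exists>t. [c i * (Q * d) * t = 1] (mod f) \<and> coprime t P \<and> 0 < t" if "i \<in> {1..k}" for i
  proof -
    have "c i dvd P"
      using that by (auto simp: c(1))
    then have "coprime (c i) f"
      using cop_f(2) coprime_divisors dvd_refl by blast
    then have "coprime (c i * (Q * d)) f"
      using cop_f(1) coprime_d_f by simp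
    then show ?thesis
      using obtain_large_inverse_mod[of "c i * (Q * d)" f P 0] cop_f(2) f_pos \<open>0 < P\<close>
      by (metis coprime_commute)
  qed
  then obtain t where
    t: "\<And>i. i \<in> {1..k} \<Longrightarrow> [c i * (Q * d) * t i = 1] (mod f) \<and> coprime (t i) P \<and> 0 < t i"
    by metis
  define w where "w i = Q * d * t i" for i
  define g where "g i = c i * w i" for i
  have c_gt_1: "1 < c i" if "i \<in> {1..k}" for i
    using c(2)[OF that] A prime_gt_1_nat by blast
  have g: "g \<in> {1..k} \<rightarrow> carrier M"
  proof
    fix i assume i: "i \<in> {1..k}"
    have "0 < g i"
      using t[OF i] c_gt_1[OF i] \<open>0 < Q\<close> d_gt_1 by (simp add: g_def w_def)
    then show "g i \<in> carrier M"
      using t[OF i] by (auto simp: carrier_iff g_def w_def mult.assoc)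
  qed
  have prod_g: "(\<Prod>i\<in>S. g i) = (\<Prod>i\<in>S. c i) * (\<Prod>i\<in>S. w i)" for S
    by (simp add: g_def prod.distrib)
  \<comment> \<open>Since \<open>A\<close> is nonempty there is a first factor, and its
    \<open>w 1\<close> alone supplies \<open>Q * d\<close>.\<close>
  have "1 \<in> {1..k}"
    using False by (auto simp: k_def Suc_le_eq nonempty_has_size)
  then have "w 1 dvd (\<Prod>i=1..k. w i)"
    by (intro dvd_prodI) auto
  then have "Q * d dvd (\<Prod>i=1..k. w i)"
    unfolding w_def by (rule dvd_mult_left)
  then have "P * (Q * d) dvd (\<Prod>i=1..k. g i)"
    unfolding prod_g c(1)[symmetric] by (intro mult_dvd_mono) auto
  then have "x * d dvd (\<Prod>i=1..k. g i)"
    by (simp add: x(3) P_def ac_simps)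
  then have "x divides\<^bsub>M\<^esub> (\<Prod>i=1..k. g i)"
    using divides_iff[OF x(1,2)] prod_in_carrier[OF _ g] by simp
  moreover have "\<not> x divides\<^bsub>M\<^esub> (\<Prod>i\<in>S. g i)" if S: "S \<subset> {1..k}" for S
  proof
    assume "x divides\<^bsub>M\<^esub> (\<Prod>i\<in>S. g i)"
    \<comment> \<open>Ordinary divisibility by \<open>x\<close> already leads to a contradiction, so
      the two cases of \<open>divides_iff\<close> need not be separated.\<close>
    then have "x dvd (\<Prod>i\<in>S. g i)"
      by (auto simp: factor_def)
    then have "P dvd (\<Prod>i\<in>S. c i) * (\<Prod>i\<in>S. w i)"
      unfolding prod_g x(3) P_def by (rule dvd_mult_right)
    moreover have "coprime P (\<Prod>i\<in>S. w i)"
      using S t cop by (intro prod_coprime_right) (auto simp: w_def P_def coprime_commute)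
    ultimately have "P dvd (\<Prod>i\<in>S. c i)"
      using coprime_dvd_mult_left_iff by blast
    moreover have pos: "0 < (\<Prod>i\<in>S. c i)"
      using S c_gt_1 by (intro prod_pos) force
    ultimately have le: "P \<le> (\<Prod>i\<in>S. c i)"
      by (rule dvd_imp_le)
    \<comment> \<open>The omitted primes make the product over \<open>S\<close> strictly smaller
      than \<open>P\<close>, which is supposed to divide it.\<close>
    have "1 < (\<Prod>i\<in>{1..k} - S. c i)"
    proof -
      obtain i where i: "i \<in> {1..k} - S"
        using S by blast
      have "c i \<le> (\<Prod>i\<in>{1..k} - S. c i)"
        using i by (intro dvd_imp_le dvd_prodI prod_pos) (auto intro: less_trans[OF zero_less_one c_gt_1])
      then show ?thesis
        using c_gt_1[of i] i by simp
    qed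
    then have "1 * (\<Prod>i\<in>S. c i) < (\<Prod>i\<in>{1..k} - S. c i) * (\<Prod>i\<in>S. c i)"
      using pos by (rule mult_strict_right_mono)
    also have "\<dots> = P"
      using prod.subset_diff[of S "{1..k}" c] S c(1) by auto
    finally show False
      using le by simp
  qed
  ultimately show ?thesis
    using omega_bound_ge[OF bound g] by (simp add: k_def)
qed simp

end

section \<open>Ceilings and the final formula\<close>

text \<open>The two bounds characterise \<open>N\<close> as the least integer with
  \<open>N * r \<ge> 2 * r + e\<close>. The summand 1 accounts for the extra factor \<open>d\<close>
  in \<open>x * d\<close>.\<close>

lemma ceiling_ratio_bounds:
  fixes r e :: nat
  assumes "0 < r"
  defines "N \<equiv> 1 + nat \<lceil>real (r + e) / real r\<rceil>"
  shows "2 * r + e \<le> N * r" and "(N - 1) * r < 2 * r + e"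
proof -
  define c where "c = nat \<lceil>real (r + e) / real r\<rceil>"
  have c: "real c = of_int \<lceil>real (r + e) / real r\<rceil>"
    by (simp add: c_def)
  have "real (r + e) / real r \<le> real c"
    unfolding c by (rule le_of_int_ceiling)
  then have "real (r + e) \<le> real (c * r)"
    using assms(1) by (simp add: field_simps)
  then have "r + e \<le> c * r"
    by (simp only: of_nat_le_iff)
  then show "2 * r + e \<le> N * r"
    by (simp add: N_def c_def)
  have "real c - 1 < real (r + e) / real r"
    unfolding c by linarith
  then have "real (c * r) < real (2 * r + e)"
    using assms(1) by (simp add: field_simps)
  then have "c * r < 2 * r + e"
    by (simp only: of_nat_less_iff)
  then show "(N - 1) * r < 2 * r + e"
    by (simp add: N_def c_def)
qed

theorem proposition3p2:
  fixes a b m n x :: nat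
    and q r e p s :: "nat \<Rightarrow> nat"
  assumes "1 < a" and "1 < b" and "a \<le> b"
    and "[a\<^sup>2 = a] (mod b)"
    and "gcd a b \<noteq> 1"
    and "gcd a b = (\<Prod>i=1..m. q i ^ r i)"
    and "\<And>i. i \<in> {1..m} \<Longrightarrow> Factorial_Ring.prime (q i)"
    and "inj_on q {1..m}"
    and "\<And>i. i \<in> {1..m} \<Longrightarrow> 0 < r i"
    and "x \<in> carrier (acm a b)"
    and "x = (\<Prod>i=1..m. q i ^ (r i + e i)) * (\<Prod>j=1..n. p j ^ s j)"
    and "\<And>j. j \<in> {1..n} \<Longrightarrow> Factorial_Ring.prime (p j)"
    and "inj_on p {1..n}"
    and "\<And>j. j \<in> {1..n} \<Longrightarrow> 0 < s j"
    and "\<And>i j. i \<in> {1..m} \<Longrightarrow> j \<in> {1..n} \<Longrightarrow> p j \<noteq> q i"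
  shows "omega_primality (acm a b) x =
    enat (Max ((\<lambda>i. 1 + nat \<lceil>real (r i + e i) / real (r i)\<rceil>) ` {1..m} \<union> {\<Sum>j=1..n. s j}))"
proof -
  interpret singular_acm a b
    using assms(1,3-5) by unfold_locales auto
  let ?Q = "\<Prod>i=1..m. q i ^ (r i + e i)"
  let ?P = "\<Prod>j=1..n. p j ^ s j"
  let ?c = "\<lambda>i. 1 + nat \<lceil>real (r i + e i) / real (r i)\<rceil>"
  define N where "N = Max (?c ` {1..m} \<union> {\<Sum>j=1..n. s j})"
  have N_ge: "?c i \<le> N" if "i \<in> {1..m}" for i
    unfolding N_def using that by (intro Max_ge) auto
  have N_ge_sum: "(\<Sum>j=1..n. s j) \<le> N"
    unfolding N_def by (intro Max_ge) auto
  obtain A where A: "prod_mset A = ?P" "size A = (\<Sum>j=1..n. s j)"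
    "\<And>c. c \<in># A \<Longrightarrow> Factorial_Ring.prime c"
    using prod_prime_powers_as_prod_mset[of "{1..n}" p s] assms(12) by auto
  have d_eq: "d = (\<Prod>i=1..m. q i ^ r i)"
    using assms(6) by (simp add: d_def)
  have cop_pq: "coprime (q i) (p j)" if "i \<in> {1..m}" "j \<in> {1..n}" for i j
    using that assms(7,12) assms(15)[OF that] by (intro primes_coprime) auto
  have cop_q: "coprime (q i) (q j)" if "i \<in> {1..m}" "j \<in> {1..m}" "i \<noteq> j" for i j
    using that assms(7) inj_onD[OF assms(8)] by (intro primes_coprime) auto
  have "coprime ?Q ?P" "coprime d ?P"
    unfolding d_eq by (intro prod_coprime_left prod_coprime_right; simp add: cop_pq)+
  then have cop: "coprime ?Q (prod_mset A)" "coprime d (prod_mset A)"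
    by (simp_all only: A(1))
  have x: "x = ?Q * prod_mset A"
    using assms(11) A(1) by simp
  have "d dvd ?Q"
    unfolding d_eq by (intro prod_dvd_prod) (simp add: le_imp_power_dvd)
  then have "d dvd x"
    by (simp add: x)
  then have "x \<noteq> 1"
    using d_gt_1 by auto
  \<comment> \<open>With no primes \<open>q i\<close> the product would give \<open>d = 1\<close>.
    The term for \<open>q 1\<close> makes \<open>N\<close> positive even if
    \<open>n = 0\<close>.\<close>
  have "1 \<le> m"
    using d_gt_1 d_eq by (cases m) auto
  then have "0 < N"
    using N_ge[of 1] by simp
  have "?Q * d dvd d ^ N"
  proof -
    \<comment> \<open>Compares the exponents of \<open>q i\<close> in \<open>?Q * d\<close> and in
      \<open>d ^ N\<close>.\<close>
    have "(r i + e i) + r i \<le> r i * N" if i: "i \<in> {1..m}" for i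
    proof -
      have "2 * r i + e i \<le> ?c i * r i"
        using ceiling_ratio_bounds(1) assms(9) i by blast
      also have "\<dots> \<le> N * r i"
        using N_ge[OF i] by (rule mult_right_mono) simp
      finally show ?thesis
        by (simp add: mult.commute)
    qed
    then have "(\<Prod>i=1..m. q i ^ ((r i + e i) + r i)) dvd (\<Prod>i=1..m. q i ^ (r i * N))"
      by (intro prod_dvd_prod le_imp_power_dvd)
    then show ?thesis
      by (simp add: d_eq power_add power_mult prod.distrib prod_power_distrib)
  qed
  then have "omega_bound x N"
    using omega_bound_upper[OF assms(10) \<open>x \<noteq> 1\<close> x A(3) cop(2)] \<open>0 < N\<close> N_ge_sum A(2) by simp
  moreover have "N \<le> l" if bound: "omega_bound x l" for l
  proof -
    have "?c i \<le> l" if i: "i \<in> {1..m}" for i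
    proof -
      let ?x' = "(\<Prod>j\<in>{1..m} - {i}. q j ^ (r j + e j)) * ?P"
      let ?d' = "\<Prod>j\<in>{1..m} - {i}. q j ^ r j"
      have "x = q i ^ (r i + e i) * ?x'"
        using assms(11) prod.remove[of "{1..m}" i "\<lambda>j. q j ^ (r j + e j)"] i
        by (simp add: mult.assoc)
      moreover have "d = q i ^ r i * ?d'"
        using d_eq prod.remove[of "{1..m}" i "\<lambda>j. q j ^ r j"] i by simp
      \<comment> \<open>Arbitrary exponents \<open>h\<close> serve both for \<open>?x'\<close>, with
        \<open>r j + e j\<close>, and for \<open>?d'\<close>, with \<open>r j\<close>.\<close>
      moreover have "coprime (q i) (\<Prod>j\<in>{1..m} - {i}. q j ^ h j)" for h
      proof (rule prod_coprime_right)
        show "coprime (q i) (q j ^ h j)" if "j \<in> {1..m} - {i}" for j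
          using that i cop_q[of i j] by auto
      qed
      moreover from this have "coprime (q i) ?x'"
        using cop_pq[OF i] by (auto intro!: prod_coprime_right)
      ultimately show ?thesis
        using omega_bound_ge_singular_prime[OF bound assms(10) \<open>x \<noteq> 1\<close>] assms(7,9)[OF i]
          ceiling_ratio_bounds by blast
    qed
    moreover have "(\<Sum>j=1..n. s j) \<le> l"
      using omega_bound_ge_size[OF bound assms(10) \<open>x \<noteq> 1\<close> x A(3) cop] A(2) by simp
    ultimately show ?thesis
      unfolding N_def by (intro Max.boundedI) auto
  qed
  ultimately show ?thesis
    unfolding N_def[symmetric] by (rule omega_primality_eqI)
qed

end
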